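(* Consider the Uniformed Patroller game on the star network $S_n$ with $n$ arcs and attack duration (difficulty) $m$, where $m\ge 2$ is any odd integer. Then: 1. The unique optimal strategy for the Patroller is the random walk, i.e. in every period he moves to a uniformly random adjacent node and never remains at the same node (which implies that he reflects at the ends). 2. An optimal strategy for the Attacker is an attack at any end node with an arbitrary delay. 3. The value of the game is $$V=1-\left(\frac{n-1}{n}\right)^{(m-1)/2}.$$
   Context: Star network: $S_n$ consists of a single center $c$ joined by an edge to each of $n$ end nodes. Patroller strategies: time is discrete. A Patroller strategy is an ergodic Markov chain on the nodes of the network (in each period he moves along an edge or stays put), required to respect all symmetries of the network; the random walk is counted among these strategies. On $S_n$ such a strategy is described by two parameters: from an end node he moves to the center (reflects) with probability $s$ and otherwise stays; from the center he moves to each given end with the same probability $p\in[0,1/n]$ and stays at the center with probability $r=1-np$. The random walk is $s=1$, $p=1/n$. Attacker strategies: a pure strategy is a pair $(i,d)$, where $i$ is a node and the positive integer $d$ is the delay; delays are bounded by a commonly known positive integer $D$, i.e. $d\le D$. The Attacker waits at node $i$ until the Patroller has been at $i$ and has then been away from $i$ for $d$ consecutive periods (the count is reset each time he returns to $i$). The attack at $i$ begins in the $d$-th such consecutive period of absence and occupies $m$ consecutive periods, the first being that period. The attack is intercepted if the Patroller is at $i$ in at least one of these $m$ periods. The Attacker only observes whether or not the Patroller is at node $i$. Payoff: the Patroller maximizes, and the Attacker minimizes, the probability that the attack is intercepted. The Patroller's Markovian strategy is known to the Attacker (Stackelberg approach with the Patroller moving first), so the value $V$ is the maximum over Patroller strategies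 of the minimum over Attacker strategies of the interception probability. A Patroller strategy is optimal if it guarantees interception probability at least $V$; an Attacker strategy is optimal if it keeps the interception probability at most $V$.
   Formalization: Uniqueness of the optimal Patroller strategy is claimed only if D≥2, m≠3 or n=1; for D=1, m=3, n≥2 it fails, since p=1/n with reflection probability s slightly below 1 is also optimal. *)

theory Defs
  imports "HOL-Probability.Probability"
begin

text \<open>
  The end nodes are the elements of a finite type \<open>'e\<close>, so the number of arcs is \<open>n = CARD('e)\<close>.
\<close>

datatype 'e node = Center | End 'e

lemma UNIV_node: "(UNIV :: 'e node set) = insert Center (range End)"
  by (auto intro: node.exhaust)

instance node :: (finite) finite
  by standard (simp add: UNIV_node)

fun adj :: "'e node \<Rightarrow> 'e node \<Rightarrow> bool" where
  "adj Center (End e) = True"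
| "adj (End e) Center = True"
| "adj Center Center = False"
| "adj (End e) (End e') = False"

text \<open>
  For at least two arcs every graph automorphism fixes the center; the explicit
  requirement only matters for the star with one arc, whose two nodes keep their
  roles as center and end.
\<close>

definition symmetry :: "('e node \<Rightarrow> 'e node) \<Rightarrow> bool" where
  "symmetry \<pi> \<longleftrightarrow> bij \<pi> \<and> \<pi> Center = Center \<and> (\<forall>u v. adj (\<pi> u) (\<pi> v) \<longleftrightarrow> adj u v)"

type_synonym 'e kernel = "'e node \<Rightarrow> 'e node pmf"

definition irreducible_kernel :: "'e kernel \<Rightarrow> bool" where
  "irreducible_kernel K \<longleftrightarrow> (\<forall>u v. (u, v) \<in> {(x, y). y \<in> set_pmf (K x)}\<^sup>*)"

text \<open>
  Ergodicity means irreducibility here (on a finite state space this gives positive recurrence).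
  Aperiodicity is not required, because the random walk has period two.
\<close>

definition patroller_strategy :: "'e kernel \<Rightarrow> bool" where
  "patroller_strategy K \<longleftrightarrow>
     (\<forall>u. \<forall>v \<in> set_pmf (K u). v = u \<or> adj u v) \<and>
     (\<forall>\<pi>. symmetry \<pi> \<longrightarrow> (\<forall>u. K (\<pi> u) = map_pmf \<pi> (K u))) \<and>
     irreducible_kernel K"

definition random_walk :: "'e::finite kernel" where
  "random_walk u = pmf_of_set {v. adj u v}"

text \<open>
  \<open>M\<close> is the law, on infinite trajectories, of a Markov chain with transition kernel \<open>K\<close>
  and an arbitrary initial distribution.
\<close>

definition markov_chain_law :: "'e kernel \<Rightarrow> (nat \<Rightarrow> 'e node) measure \<Rightarrow> bool" where
  "markov_chain_law K M \<longleftrightarrow>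
     prob_space M \<and>
     sets M = sets (\<Pi>\<^sub>M t\<in>UNIV. count_space UNIV) \<and>
     (\<forall>x k. measure M {X. \<forall>t \<le> Suc k. X t = x t} =
            measure M {X. \<forall>t \<le> k. X t = x t} * pmf (K (x k)) (x (Suc k)))"

text \<open>
  Period \<open>t\<close> is the \<open>d\<close>-th consecutive period of absence from \<open>i\<close> after a visit to \<open>i\<close>.
\<close>

definition absence_completed :: "'e node \<Rightarrow> nat \<Rightarrow> (nat \<Rightarrow> 'e node) \<Rightarrow> nat \<Rightarrow> bool" where
  "absence_completed i d X t \<longleftrightarrow> d \<le> t \<and> X (t - d) = i \<and> (\<forall>u \<in> {t - d<..t}. X u \<noteq> i)"

definition attack_start :: "'e node \<Rightarrow> nat \<Rightarrow> (nat \<Rightarrow> 'e node) \<Rightarrow> nat" where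
  "attack_start i d X = (LEAST t. absence_completed i d X t)"

text \<open>
  The payoff convention for attacks that never take place: they do not count as successful,
  i.e. they count for the Patroller. Without it, waiting forever (e.g. with delay two at the center
  against the random walk) would be a perfect attack. Against an irreducible chain a
  pair \<open>(i, d)\<close> leads to an attack either almost surely or almost never, so the convention
  affects only pairs that almost never lead to an attack.
\<close>

definition foiled :: "nat \<Rightarrow> 'e node \<Rightarrow> nat \<Rightarrow> (nat \<Rightarrow> 'e node) \<Rightarrow> bool" where
  "foiled m i d X \<longleftrightarrow>
     ((\<exists>t. absence_completed i d X t) \<longrightarrow>
      (\<exists>u \<in> {attack_start i d X ..< attack_start i d X + m}. X u = i))"

definition interception_prob ::
    "(nat \<Rightarrow> 'e node) measure \<Rightarrow> nat \<Rightarrow> 'e node \<times> nat \<Rightarrow> real" where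
  "interception_prob M m a = measure M {X. foiled m (fst a) (snd a) X}"

text \<open>
  In the following, \<open>P K\<close> is the law of the trajectory when the Patroller uses \<open>K\<close>,
  \<open>m\<close> is the attack duration and \<open>D\<close> the bound on the delays.
\<close>

definition attacker_strategies :: "nat \<Rightarrow> ('e node \<times> nat) set" where
  "attacker_strategies D = UNIV \<times> {1..D}"

definition guaranteed_prob ::
    "('e::finite kernel \<Rightarrow> (nat \<Rightarrow> 'e node) measure) \<Rightarrow> nat \<Rightarrow> nat \<Rightarrow> 'e kernel \<Rightarrow> real" where
  "guaranteed_prob P m D K = Min (interception_prob (P K) m ` attacker_strategies D)"

definition game_value ::
    "('e::finite kernel \<Rightarrow> (nat \<Rightarrow> 'e node) measure) \<Rightarrow> nat \<Rightarrow> nat \<Rightarrow> real" where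
  "game_value P m D = (SUP K \<in> Collect patroller_strategy. guaranteed_prob P m D K)"

text \<open>
  The supremum in \<open>game_value\<close> is a maximum iff there is an optimal Patroller strategy.
  For \<open>D = 1\<close>, \<open>m = 3\<close> and at least two arcs the optimal strategy is not unique: with delay one
  at an end the Patroller has only two moves left from the center, so the reflection
  probability \<open>s\<close> does not matter there, and the center is safe if \<open>s\<close> is close to one.
\<close>

definition optimal_patroller ::
    "('e::finite kernel \<Rightarrow> (nat \<Rightarrow> 'e node) measure) \<Rightarrow> nat \<Rightarrow> nat \<Rightarrow> 'e kernel \<Rightarrow> bool" where
  "optimal_patroller P m D K \<longleftrightarrow>
     patroller_strategy K \<and> guaranteed_prob P m D K \<ge> game_value P m D"

definition optimal_attacker ::
    "('e::finite kernel \<Rightarrow> (nat \<Rightarrow> 'e node) measure) \<Rightarrow> nat \<Rightarrow> nat \<Rightarrow> 'e node \<times> nat \<Rightarrow> bool" where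
  "optimal_attacker P m D a \<longleftrightarrow>
     a \<in> attacker_strategies D \<and>
     (\<forall>K. patroller_strategy K \<longrightarrow> interception_prob (P K) m a \<le> game_value P m D)"

text \<open>Markov chains with given kernel and initial distribution exist.\<close>

primrec path_of :: "(nat \<times> 'e node \<Rightarrow> 'e node) \<Rightarrow> nat \<Rightarrow> 'e node" where
  "path_of f 0 = f (0, Center)"
| "path_of f (Suc t) = f (Suc t, path_of f t)"

lemma markov_chain_law_exists:
  fixes K :: "'e::finite kernel" and \<mu> :: "'e node pmf"
  shows "\<exists>M. markov_chain_law K M \<and> (\<forall>v. measure M {X. X 0 = v} = pmf \<mu> v)"
proof -
  define N :: "nat \<times> 'e node \<Rightarrow> 'e node pmf" where
    "N j = (case fst j of 0 \<Rightarrow> \<mu> | Suc _ \<Rightarrow> K (snd j))" for j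
  define Q where "Q = (\<Pi>\<^sub>M j\<in>UNIV. measure_pmf (N j))"
  let ?S = "\<Pi>\<^sub>M t\<in>(UNIV::nat set). count_space (UNIV :: 'e node set)"
  define M where "M = distr Q ?S path_of"
  interpret PS: product_prob_space "\<lambda>j. measure_pmf (N j)" UNIV
    by unfold_locales
  have prob_Q: "prob_space Q" unfolding Q_def by (rule PS.P.prob_space_axioms)
  have space_Q: "space Q = UNIV" by (simp add: Q_def space_PiM)
  have coord: "(\<lambda>f. f j) \<in> measurable Q (count_space UNIV)" for j
  proof -
    have "(\<lambda>f. f j) \<in> measurable Q (measure_pmf (N j))"
      unfolding Q_def by (rule measurable_component_singleton) simp
    then show ?thesis by (simp cong: measurable_cong_sets)
  qed
  have pcoord: "(\<lambda>f. path_of f t) \<in> measurable Q (count_space UNIV)" for t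
  proof (induction t)
    case 0
    then show ?case using coord by simp
  next
    case (Suc t)
    have "(\<lambda>f. (\<lambda>v f. f (Suc t, v)) (path_of f t) f) \<in> measurable Q (count_space UNIV)"
      by (rule measurable_compose_countable'[OF _ Suc]) (auto intro: coord)
    then show ?case by simp
  qed
  have meas: "path_of \<in> measurable Q ?S"
    by (rule measurable_PiM_single') (auto intro: pcoord)
  have cyl_sets: "{X. \<forall>t \<le> k. X t = x t} \<in> sets ?S" for k and x :: "nat \<Rightarrow> 'e node"
  proof -
    have "{X \<in> space ?S. \<forall>t \<in> {..k}. X t = x t} \<in> sets ?S"
      by measurable
    moreover have "{X \<in> space ?S. \<forall>t \<in> {..k}. X t = x t} = {X. \<forall>t \<le> k. X t = x t}"
      by (auto simp: space_PiM)
    ultimately show ?thesis by simp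
  qed
  have cyl: "measure M {X. \<forall>t \<le> k. X t = x t} =
      (\<Prod>t\<le>k. pmf (N (t, case t of 0 \<Rightarrow> Center | Suc u \<Rightarrow> x u)) (x t))" for k and x :: "nat \<Rightarrow> 'e node"
  proof -
    define g where "g t = (t, case t of 0 \<Rightarrow> Center | Suc u \<Rightarrow> x u)" for t
    have inj: "inj_on g A" for A by (auto simp: inj_on_def g_def)
    have ev: "(\<forall>t \<le> k. path_of f t = x t) \<longleftrightarrow> (\<forall>t \<le> k. f (g t) = x t)" for f
    proof (induction k)
      case 0
      then show ?case by (simp add: g_def)
    next
      case (Suc k)
      have "(\<forall>t\<le>Suc k. path_of f t = x t) \<longleftrightarrow>
          (\<forall>t\<le>k. path_of f t = x t) \<and> path_of f (Suc k) = x (Suc k)"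
        by (auto simp: le_Suc_eq)
      also have "\<dots> \<longleftrightarrow> (\<forall>t\<le>k. path_of f t = x t) \<and> f (g (Suc k)) = x (Suc k)"
        by (auto simp: g_def)
      also have "\<dots> \<longleftrightarrow> (\<forall>t\<le>Suc k. f (g t) = x t)"
        using Suc by (auto simp: le_Suc_eq)
      finally show ?case .
    qed
    have "measure M {X. \<forall>t \<le> k. X t = x t} = measure Q {f. \<forall>t \<le> k. f (g t) = x t}"
      unfolding M_def using meas cyl_sets
      by (subst measure_distr) (auto simp: ev space_Q vimage_def)
    also have "{f. \<forall>t \<le> k. f (g t) = x t} =
        prod_emb UNIV (\<lambda>j. measure_pmf (N j)) (g ` {..k}) (Pi\<^sub>E (g ` {..k}) (\<lambda>j. {x (fst j)}))"
      by (auto simp: prod_emb_def PiE_iff g_def)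
    also have "measure Q \<dots> = (\<Prod>j\<in>g ` {..k}. measure (measure_pmf (N j)) {x (fst j)})"
      unfolding Q_def by (subst PS.measure_PiM_emb) auto
    also have "\<dots> = (\<Prod>t\<le>k. pmf (N (g t)) (x t))"
      by (subst prod.reindex[OF inj]) (simp add: measure_pmf_single g_def)
    finally show ?thesis by (simp add: g_def)
  qed
  have "markov_chain_law K M"
    unfolding markov_chain_law_def
  proof (intro conjI allI)
    show "prob_space M"
      unfolding M_def by (rule prob_space.prob_space_distr[OF prob_Q meas])
    show "sets M = sets ?S" by (simp add: M_def)
  qed (simp add: cyl N_def)
  moreover have "measure M {X. X 0 = v} = pmf \<mu> v" for v
    using cyl[of 0 "\<lambda>_. v"] by (simp add: N_def)
  ultimately show ?thesis by blast
qed

text \<open>The Patroller strategies form the usual two-parameter family.\<close>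

lemma symmetry_map_node: "bij f \<Longrightarrow> symmetry (map_node f)"
proof -
  assume f: "bij f"
  have "bij (map_node f)"
  proof (rule bijI)
    show "inj (map_node f)" using f by (simp add: bij_is_inj node.inj_map)
    show "surj (map_node f)"
    proof (rule surjI)
      fix v show "map_node f (map_node (inv f) v) = v"
        using f by (cases v) (auto simp: bij_is_surj surj_f_inv_f)
    qed
  qed
  moreover have "adj (map_node f u) (map_node f v) = adj u v" for u v
    by (cases u; cases v) auto
  ultimately show ?thesis by (simp add: symmetry_def)
qed

lemma patroller_strategy_iff:
  fixes K :: "'e::finite kernel"
  shows "patroller_strategy K \<longleftrightarrow>
    (\<exists>s p. 0 < s \<and> s \<le> 1 \<and> 0 < p \<and> p \<le> 1 / real CARD('e) \<and>
      (\<forall>e. pmf (K (End e)) Center = s \<and> pmf (K (End e)) (End e) = 1 - s) \<and>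
      pmf (K Center) Center = 1 - real CARD('e) * p \<and> (\<forall>e. pmf (K Center) (End e) = p))"
proof
  assume K: "patroller_strategy K"
  then have move: "v = u \<or> adj u v" if "v \<in> set_pmf (K u)" for u v
    using that by (auto simp: patroller_strategy_def)
  have sym: "pmf (K (\<pi> u)) (\<pi> v) = pmf (K u) v" if "symmetry \<pi>" for \<pi> u v
  proof -
    have "K (\<pi> u) = map_pmf \<pi> (K u)" using K that by (auto simp: patroller_strategy_def)
    then show ?thesis
      using that by (simp add: pmf_map_inj' symmetry_def bij_is_inj)
  qed
  have irr: "(u, v) \<in> {(x, y). y \<in> set_pmf (K x)}\<^sup>*" for u v
    using K by (auto simp: patroller_strategy_def irreducible_kernel_def)
  have leave: "\<exists>v. v \<noteq> u \<and> v \<in> set_pmf (K u)" if "w \<noteq> u" for u w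
  proof (rule ccontr)
    assume stuck: "\<not> ?thesis"
    have "w = u" using irr[of u w]
      by (induction rule: rtrancl_induct) (use stuck in auto)
    with that show False by simp
  qed
  define e0 :: 'e where "e0 = undefined"
  define s where "s = pmf (K (End e0)) Center"
  define p where "p = pmf (K Center) (End e0)"
  let ?f = "\<lambda>e. map_node (Transposition.transpose e0 e)"
  have f: "symmetry (?f e)" for e by (rule symmetry_map_node) simp
  have s: "pmf (K (End e)) Center = s" for e
    using sym[OF f[of e], of "End e0" Center] by (simp add: s_def)
  have p: "pmf (K Center) (End e) = p" for e
    using sym[OF f[of e], of Center "End e0"] by (simp add: p_def)
  have stay: "pmf (K (End e)) (End e) = 1 - s" for e
  proof -
    have "set_pmf (K (End e)) \<subseteq> {Center, End e}"
    proof
      fix v assume "v \<in> set_pmf (K (End e))"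
      from move[OF this] show "v \<in> {Center, End e}" by (cases v) auto
    qed
    then have "sum (pmf (K (End e))) {Center, End e} = 1"
      by (intro sum_pmf_eq_1) auto
    then show ?thesis by (simp add: s)
  qed
  have "sum (pmf (K Center)) UNIV = 1" by (intro sum_pmf_eq_1) auto
  moreover have "sum (pmf (K Center)) (insert Center (range End)) =
      pmf (K Center) Center + (\<Sum>e\<in>UNIV. pmf (K Center) (End e))"
    by (subst sum.insert) (auto simp: sum.reindex inj_on_def)
  ultimately have r: "pmf (K Center) Center = 1 - real CARD('e) * p"
    by (simp add: UNIV_node p)
  have "p \<le> 1 / real CARD('e)"
    using pmf_nonneg[of "K Center" Center] by (simp add: r field_simps)
  moreover have "s > 0"
  proof -
    obtain v where v: "v \<noteq> End e0" "v \<in> set_pmf (K (End e0))"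
      using leave[of Center "End e0"] by auto
    with move[OF v(2)] have "v = Center" by (cases v) auto
    with v show ?thesis by (simp add: s_def pmf_positive_iff)
  qed
  moreover have "p > 0"
  proof -
    obtain v where v: "v \<noteq> Center" "v \<in> set_pmf (K Center)"
      using leave[of "End e0" Center] by auto
    then obtain e where "v = End e" by (cases v) auto
    with v have "pmf (K Center) (End e) > 0" by (simp add: pmf_positive_iff)
    then show ?thesis by (simp add: p)
  qed
  moreover have "s \<le> 1" by (simp add: s_def pmf_le_1)
  ultimately show "\<exists>s p. 0 < s \<and> s \<le> 1 \<and> 0 < p \<and> p \<le> 1 / real CARD('e) \<and>
      (\<forall>e. pmf (K (End e)) Center = s \<and> pmf (K (End e)) (End e) = 1 - s) \<and>
      pmf (K Center) Center = 1 - real CARD('e) * p \<and> (\<forall>e. pmf (K Center) (End e) = p)"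
    using s stay r p by blast
next
  assume "\<exists>s p. 0 < s \<and> s \<le> 1 \<and> 0 < p \<and> p \<le> 1 / real CARD('e) \<and>
      (\<forall>e. pmf (K (End e)) Center = s \<and> pmf (K (End e)) (End e) = 1 - s) \<and>
      pmf (K Center) Center = 1 - real CARD('e) * p \<and> (\<forall>e. pmf (K Center) (End e) = p)"
  then obtain s p where sp: "0 < s" "0 < p"
    "\<And>e. pmf (K (End e)) Center = s" "\<And>e. pmf (K (End e)) (End e) = 1 - s"
    "\<And>e. pmf (K Center) (End e) = p" by blast
  have zero: "pmf (K (End e)) (End e') = 0" if "e' \<noteq> e" for e e'
  proof -
    have "sum (pmf (K (End e))) {Center, End e, End e'} \<le> sum (pmf (K (End e))) UNIV"
      by (rule sum_mono2) auto
    also have "\<dots> = 1" by (intro sum_pmf_eq_1) auto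
    finally have "pmf (K (End e)) (End e') \<le> 0" using that by (auto simp: sp)
    then show ?thesis by (simp add: order_antisym)
  qed
  have move: "v = u \<or> adj u v" if "v \<in> set_pmf (K u)" for u v
  proof (cases u)
    case Center
    then show ?thesis by (cases v) auto
  next
    case (End e)
    show ?thesis
    proof (cases v)
      case (End e')
      have "e' = e"
        using that zero[of e' e] \<open>u = End e\<close> \<open>v = End e'\<close> by (auto simp: set_pmf_iff)
      then show ?thesis using \<open>u = End e\<close> \<open>v = End e'\<close> by simp
    qed (use \<open>u = End e\<close> in simp)
  qed
  have "K (\<pi> u) = map_pmf \<pi> (K u)" if \<pi>: "symmetry \<pi>" for \<pi> u
  proof (rule pmf_eqI)
    have inj: "inj \<pi>" and surj: "surj \<pi>" and c: "\<pi> Center = Center"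
      using \<pi> by (auto simp: symmetry_def bij_is_inj bij_is_surj)
    have ends: "\<exists>e'. \<pi> (End e) = End e'" for e
      using inj c by (cases "\<pi> (End e)") (auto dest: injD[of \<pi> "End e" Center])
    fix w
    obtain v where v: "w = \<pi> v" using surj by blast
    have "pmf (K (\<pi> u)) (\<pi> v) = pmf (K u) v"
    proof (cases u; cases v)
      fix e e' assume uv: "u = End e" "v = End e'"
      obtain a b where ab: "\<pi> (End e) = End a" "\<pi> (End e') = End b" using ends by metis
      then have "a = b \<longleftrightarrow> e = e'"
        using inj by (metis injD node.inject)
      then show ?thesis using uv ab by (cases "e = e'") (auto simp: sp zero)
    next
      fix e assume "u = Center" "v = End e"
      then show ?thesis using ends[of e] c by (auto simp: sp)
    next
      fix e assume "u = End e" "v = Center"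
      then show ?thesis using ends[of e] c by (auto simp: sp)
    qed (simp add: c)
    then show "pmf (K (\<pi> u)) w = pmf (map_pmf \<pi> (K u)) w"
      using inj v by (simp add: pmf_map_inj')
  qed
  moreover have "irreducible_kernel K"
  proof -
    let ?R = "{(x, y). y \<in> set_pmf (K x)}"
    have to_center: "(u, Center) \<in> ?R\<^sup>*" for u
      using sp by (cases u) (auto simp: set_pmf_iff intro!: r_into_rtrancl)
    have from_center: "(Center, v) \<in> ?R\<^sup>*" for v
      using sp by (cases v) (auto simp: set_pmf_iff intro!: r_into_rtrancl)
    show ?thesis unfolding irreducible_kernel_def
      using to_center from_center by (blast intro: rtrancl_trans)
  qed
  ultimately show "patroller_strategy K"
    using move by (auto simp: patroller_strategy_def)
qed

end

theory Submission
  imports Defs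
begin

text \<open>
  Write \<open>n\<close> for the number of arcs and \<open>m - 1 = 2 * j\<close>. When an attack on the end \<open>e\<close> begins, the
  Patroller is away from \<open>e\<close>, either at the center or at another end, and the attack succeeds iff he
  avoids \<open>e\<close> during the next \<open>2 * j\<close> steps. By the Markov property, the probability of this depends
  only on his position at the beginning, and the delay matters only through the distribution of that
  position. So everything reduces to the probabilities \<open>avoid_prob\<close> of avoiding a node for a number
  of steps.

  Two consecutive steps take the Patroller to at most one new end, because between two ends he has to
  pass through the center. From the center he picks \<open>e\<close> out of \<open>n\<close> ends with
  probability at most \<open>1/n\<close>, so two steps avoid \<open>e\<close> with probability at least
  \<open>\<beta> = (n - 1)/n\<close>, and \<open>2 * j\<close> steps with probability at least \<open>\<beta> ^ j\<close> (\<open>avoid_even_ge\<close>). This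
  bounds the interception probability at an end for every Patroller strategy and every delay, once it
  is known that the attack takes place almost surely (\<open>absence_completed_almost_surely\<close>), which holds
  because an irreducible chain has infinitely many chances to make the required absence. The random
  walk attains the bound from both kinds of starting position (\<open>avoid_random_walk\<close>). It returns to the
  center at once, so that an attack there is intercepted, or never takes place if the delay exceeds one.

  For uniqueness, let a strategy differ from the random walk. If it idles at the center, a step is
  wasted right after the Patroller has left \<open>e\<close>, and an attack at \<open>e\<close> with delay one does strictly
  better (\<open>avoid_idle\<close>). If it never idles at the center, but sometimes lingers at an end, time is
  wasted at the other ends. With delay two the Patroller is at another end when the attack begins
  (\<open>avoid_linger\<close>); with delay one he is at the center, but still has time to reach another end
  and to waste two steps there, provided that \<open>m \<ge> 5\<close> (\<open>avoid_linger_center\<close>). A single arc has no other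
  end; there \<open>\<beta> = 0\<close>, the value is one, and each way of staying put leaves the node at the opposite
  side of the arc uninspected with positive probability.
\<close>

section \<open>Events determined by a finite past\<close>

definition determined_by :: "nat \<Rightarrow> (nat \<Rightarrow> 'a) set \<Rightarrow> bool" where
  "determined_by t A \<longleftrightarrow> (\<forall>X Y. (\<forall>u\<le>t. X u = Y u) \<longrightarrow> (X \<in> A \<longleftrightarrow> Y \<in> A))"

lemma determined_by_Int:
  "determined_by t A \<Longrightarrow> determined_by t B \<Longrightarrow> determined_by t (A \<inter> B)"
  unfolding determined_by_def by blast

lemma determined_by_later: "determined_by t A \<Longrightarrow> t \<le> t' \<Longrightarrow> determined_by t' A"
  unfolding determined_by_def by (meson order_trans)

lemma determined_by_at: "u \<le> t \<Longrightarrow> determined_by t {X. Q (X u)}"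
  by (simp add: determined_by_def)

lemma determined_by_avoid: "determined_by (t + k) {X. \<forall>u\<in>{t<..t + k}. X u \<noteq> i}"
  by (simp add: determined_by_def)

lemma absence_completed_cong:
  assumes "\<forall>u\<le>t. X u = Y u"
  shows "absence_completed i d X t \<longleftrightarrow> absence_completed i d Y t"
  using assms by (auto simp: absence_completed_def)

text \<open>
  Canonical representatives of the paths up to time \<open>t\<close>: beyond \<open>t\<close> they are frozen to an arbitrary
  node, so that there are only finitely many of them.
\<close>

definition prefixes :: "nat \<Rightarrow> (nat \<Rightarrow> 'e node) set" where
  "prefixes t = {x. \<forall>u>t. x u = Center}"

lemma finite_prefixes: "finite (prefixes t :: (nat \<Rightarrow> 'e::finite node) set)"
proof -
  have "finite {x. \<forall>u. (u \<in> {..t} \<longrightarrow> x u \<in> (UNIV :: 'e node set)) \<and> (u \<notin> {..t} \<longrightarrow> x u = Center)}"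
    by (rule finite_set_of_finite_funs) auto
  then show ?thesis by (simp add: prefixes_def not_le)
qed

lemma determined_by_decomposition:
  assumes "determined_by t A"
  shows "A = (\<Union>x\<in>prefixes t \<inter> A. {X. \<forall>u\<le>t. X u = x u})"
proof (intro equalityI subsetI)
  fix X assume X: "X \<in> A"
  define x where "x u = (if u \<le> t then X u else Center)" for u
  have "x \<in> prefixes t" "\<forall>u\<le>t. X u = x u" by (auto simp: x_def prefixes_def)
  moreover from this X assms have "x \<in> A" unfolding determined_by_def by blast
  ultimately show "X \<in> (\<Union>x\<in>prefixes t \<inter> A. {X. \<forall>u\<le>t. X u = x u})" by blast
next
  fix X assume "X \<in> (\<Union>x\<in>prefixes t \<inter> A. {X. \<forall>u\<le>t. X u = x u})"
  then show "X \<in> A" using assms unfolding determined_by_def by blast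
qed

lemma disjoint_prefixes:
  "disjoint_family_on (\<lambda>x. {X. \<forall>u\<le>t. X u = x u} \<inter> B x) (prefixes t \<inter> A)"
proof -
  have "x = y" if "x \<in> prefixes t" "y \<in> prefixes t" "\<forall>u\<le>t. X u = x u" "\<forall>u\<le>t. X u = y u" for x y X
  proof
    fix u show "x u = y u" using that by (cases "u \<le> t") (auto simp: prefixes_def)
  qed
  then show ?thesis unfolding disjoint_family_on_def by blast
qed

section \<open>When an attack succeeds\<close>

definition starts :: "'e node \<Rightarrow> nat \<Rightarrow> nat \<Rightarrow> (nat \<Rightarrow> 'e node) set" where
  "starts i d t = {X. absence_completed i d X t \<and> (\<forall>u<t. \<not> absence_completed i d X u)}"

lemma starts_det: "determined_by t (starts i d t)"
  unfolding determined_by_def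
proof (intro allI impI)
  fix X Y :: "nat \<Rightarrow> 'a node" assume "\<forall>u\<le>t. X u = Y u"
  then have "absence_completed i d X u \<longleftrightarrow> absence_completed i d Y u" if "u \<le> t" for u
    using that by (intro absence_completed_cong) auto
  then show "X \<in> starts i d t \<longleftrightarrow> Y \<in> starts i d t" by (simp add: starts_def)
qed

lemma disjoint_starts: "disjoint_family (\<lambda>t. starts i d t \<inter> B t)"
  unfolding disjoint_family_on_def starts_def using linorder_neqE_nat by blast

lemma UN_starts: "(\<Union>t. starts i d t) = {X. \<exists>t. absence_completed i d X t}"
proof (intro equalityI subsetI)
  fix X assume "X \<in> {X. \<exists>t. absence_completed i d X t}"
  then obtain t where "absence_completed i d X t" by blast
  then have "X \<in> starts i d (LEAST t. absence_completed i d X t)"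
    unfolding starts_def by (auto intro: LeastI dest: not_less_Least)
  then show "X \<in> (\<Union>t. starts i d t)" by blast
qed (auto simp: starts_def)

text \<open>
  The start of the attack is itself a period of absence, so an attack of duration \<open>Suc k\<close> leaves only
  \<open>k\<close> steps in which the Patroller can intercept it. Splitting at the time of the start turns success into
  a disjoint union of events to which the Markov property applies.
\<close>

lemma not_foiled_eq:
  assumes "d \<ge> 1"
  shows "{X. \<not> foiled (Suc k) i d X} = (\<Union>t. starts i d t \<inter> {X. \<forall>u\<in>{t<..t + k}. X u \<noteq> i})"
proof -
  have start: "attack_start i d X = t" if "X \<in> starts i d t" for X t
    unfolding attack_start_def using that
    by (intro Least_equality) (auto simp: starts_def not_less[symmetric])
  have away: "X t \<noteq> i" if "X \<in> starts i d t" for X t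
    using that assms by (auto simp: starts_def absence_completed_def)
  have "{t..<t + Suc k} = insert t {t<..t + k}" for t by auto
  then have avoid: "\<not> foiled (Suc k) i d X \<longleftrightarrow> (\<forall>u\<in>{t<..t + k}. X u \<noteq> i)"
    if "X \<in> starts i d t" for X t
    using that start[OF that] away[OF that] by (auto simp: foiled_def starts_def)
  show ?thesis
  proof (intro equalityI subsetI)
    fix X assume X: "X \<in> {X. \<not> foiled (Suc k) i d X}"
    then have "X \<in> (\<Union>t. starts i d t)" unfolding UN_starts foiled_def by blast
    then obtain t where "X \<in> starts i d t" by blast
    with X avoid show "X \<in> (\<Union>t. starts i d t \<inter> {X. \<forall>u\<in>{t<..t + k}. X u \<noteq> i})" by blast
  qed (use avoid in blast)
qed

section \<open>The Markov property\<close>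

text \<open>
  The probability that the chain does not visit \<open>i\<close> in the \<open>k\<close> steps after being at \<open>v\<close>, where
  \<open>v = i\<close> itself is allowed.
\<close>

primrec avoid_prob :: "'e::finite kernel \<Rightarrow> 'e node \<Rightarrow> nat \<Rightarrow> 'e node \<Rightarrow> real" where
  "avoid_prob K i 0 v = 1"
| "avoid_prob K i (Suc k) v = (\<Sum>w\<in>-{i}. pmf (K v) w * avoid_prob K i k w)"

declare avoid_prob.simps(2) [simp del]

lemma avoid_prob_nonneg: "avoid_prob K i k v \<ge> 0"
  by (induction k arbitrary: v) (auto simp: avoid_prob.simps(2) intro!: sum_nonneg)

definition legal_path :: "'e kernel \<Rightarrow> (nat \<Rightarrow> 'e node) \<Rightarrow> bool" where
  "legal_path K X \<longleftrightarrow> (\<forall>t. X (Suc t) \<in> set_pmf (K (X t)))"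

locale chain =
  fixes K :: "'e::finite kernel" and M :: "(nat \<Rightarrow> 'e node) measure"
  assumes law: "markov_chain_law K M"
begin

sublocale prob_space M
  using law by (simp add: markov_chain_law_def)

lemma sets_M: "sets M = sets (\<Pi>\<^sub>M t\<in>UNIV. count_space UNIV)"
  using law by (simp add: markov_chain_law_def)

lemma space_M [simp]: "space M = UNIV"
  using sets_eq_imp_space_eq[OF sets_M] by (simp add: space_PiM)

lemma cylinder_in_sets: "{X. \<forall>t\<le>k. X t = x t} \<in> sets M"
proof -
  let ?S = "\<Pi>\<^sub>M t\<in>(UNIV::nat set). count_space (UNIV :: 'e node set)"
  have "{X \<in> space ?S. \<forall>t\<in>{..k}. X t = x t} \<in> sets ?S"
    by measurable
  moreover have "{X \<in> space ?S. \<forall>t\<in>{..k}. X t = x t} = {X. \<forall>t\<le>k. X t = x t}"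
    by (auto simp: space_PiM)
  ultimately show ?thesis by (simp add: sets_M)
qed

lemma determined_by_in_sets: "determined_by t A \<Longrightarrow> A \<in> sets M"
  by (subst determined_by_decomposition, assumption)
    (intro sets.finite_UN finite_Int disjI1 finite_prefixes cylinder_in_sets)

text \<open>
  A chain law is specified on cylinders only; since an event determined by time \<open>t\<close> is a finite disjoint
  union of cylinders, the transition rule extends to it.
\<close>

lemma prob_next:
  assumes A: "determined_by t A" "A \<subseteq> {X. X t = v}"
  shows "prob (A \<inter> {X. X (Suc t) = w}) = prob A * pmf (K v) w"
proof -
  let ?cyl = "\<lambda>x. {X. \<forall>u\<le>t. X u = x u}" and ?I = "prefixes t \<inter> A"
  have fin: "finite ?I" using finite_prefixes by blast
  have extend: "?cyl x \<inter> {X. X (Suc t) = w} = {X. \<forall>u\<le>Suc t. X u = (x(Suc t := w)) u}" for x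
    by (auto simp: le_Suc_eq)
  have step: "prob (?cyl x \<inter> {X. X (Suc t) = w}) = prob (?cyl x) * pmf (K v) w" if "x \<in> ?I" for x
  proof -
    have "prob {X. \<forall>u\<le>Suc t. X u = (x(Suc t := w)) u} =
        prob {X. \<forall>u\<le>t. X u = (x(Suc t := w)) u} * pmf (K ((x(Suc t := w)) t)) ((x(Suc t := w)) (Suc t))"
      using law unfolding markov_chain_law_def by blast
    moreover have "{X. \<forall>u\<le>t. X u = (x(Suc t := w)) u} = ?cyl x" by auto
    moreover have "x t = v" using that A by blast
    ultimately show ?thesis by (simp add: extend)
  qed
  have "prob (A \<inter> {X. X (Suc t) = w}) = prob (\<Union>x\<in>?I. ?cyl x \<inter> {X. X (Suc t) = w})"
    by (subst determined_by_decomposition[OF A(1)]) (rule arg_cong[of _ _ prob], blast)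
  also have "\<dots> = (\<Sum>x\<in>?I. prob (?cyl x \<inter> {X. X (Suc t) = w}))"
    by (rule finite_measure_finite_Union[OF fin _ disjoint_prefixes])
      (use cylinder_in_sets in \<open>auto simp del: fun_upd_apply simp: extend\<close>)
  also have "\<dots> = (\<Sum>x\<in>?I. prob (?cyl x)) * pmf (K v) w"
    by (simp add: step sum_distrib_right)
  also have "(\<Sum>x\<in>?I. prob (?cyl x)) = prob (\<Union>x\<in>?I. ?cyl x)"
    by (rule finite_measure_finite_Union[symmetric, OF fin])
      (use cylinder_in_sets disjoint_prefixes[of t "\<lambda>_. UNIV"] in auto)
  also have "(\<Union>x\<in>?I. ?cyl x) = A"
    by (rule determined_by_decomposition[OF A(1), symmetric])
  finally show ?thesis .
qed

lemma prob_split_at: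
  assumes "B \<in> sets M"
  shows "prob B = (\<Sum>v\<in>UNIV. prob (B \<inter> {X. X t = v}))"
proof -
  have at: "{X. X t = v} \<in> sets M" for v
    by (rule determined_by_in_sets[OF determined_by_at[of t t "\<lambda>x. x = v"]]) simp
  have "prob B = prob (\<Union>v\<in>UNIV. B \<inter> {X. X t = v})" by (rule arg_cong[of _ _ prob]) blast
  also have "\<dots> = (\<Sum>v\<in>UNIV. prob (B \<inter> {X. X t = v}))"
    by (rule finite_measure_finite_Union) (use assms at in \<open>auto simp: disjoint_family_on_def\<close>)
  finally show ?thesis .
qed

text \<open>
  The form of the Markov property used throughout: the past \<open>A\<close> and the avoidance of \<open>i\<close> in the future
  are independent given the present position.
\<close>

lemma prob_avoid:
  assumes "determined_by t A" "A \<subseteq> {X. X t = v}"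
  shows "prob (A \<inter> {X. \<forall>u\<in>{t<..t + k}. X u \<noteq> i}) = prob A * avoid_prob K i k v"
  using assms
proof (induction k arbitrary: t A v)
  case 0
  then show ?case by simp
next
  case (Suc k)
  let ?B = "A \<inter> {X. \<forall>u\<in>{t<..t + Suc k}. X u \<noteq> i}"
  let ?A = "\<lambda>w. A \<inter> {X. X (Suc t) = w}"
  have next_det: "determined_by (Suc t) (?A w)" for w
    by (intro determined_by_Int determined_by_at determined_by_later[OF Suc.prems(1)]) auto
  have "determined_by (t + Suc k) ?B"
    by (rule determined_by_Int[OF determined_by_later[OF Suc.prems(1)] determined_by_avoid]) simp
  then have "prob ?B = (\<Sum>w\<in>UNIV. prob (?B \<inter> {X. X (Suc t) = w}))"
    by (intro prob_split_at determined_by_in_sets)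
  also have "\<dots> = (\<Sum>w\<in>-{i}. prob (?B \<inter> {X. X (Suc t) = w}))"
  proof (rule sum.mono_neutral_right)
    show "\<forall>w\<in>UNIV - -{i}. prob (?B \<inter> {X. X (Suc t) = w}) = 0"
    proof
      fix w assume "w \<in> UNIV - -{i}"
      then have "?B \<inter> {X. X (Suc t) = w} = {}" by force
      then show "prob (?B \<inter> {X. X (Suc t) = w}) = 0" by simp
    qed
  qed auto
  also have "\<dots> = (\<Sum>w\<in>-{i}. prob A * (pmf (K v) w * avoid_prob K i k w))"
  proof (rule sum.cong)
    fix w assume w: "w \<in> -{i}"
    have split: "{t<..t + Suc k} = insert (Suc t) {Suc t<..Suc t + k}" by auto
    have "?B \<inter> {X. X (Suc t) = w} = ?A w \<inter> {X. \<forall>u\<in>{Suc t<..Suc t + k}. X u \<noteq> i}"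
      unfolding split using w by auto
    also have "prob \<dots> = prob (?A w) * avoid_prob K i k w"
      by (rule Suc.IH[OF next_det]) auto
    also have "prob (?A w) = prob A * pmf (K v) w" by (rule prob_next[OF Suc.prems])
    finally show "prob (?B \<inter> {X. X (Suc t) = w}) = prob A * (pmf (K v) w * avoid_prob K i k w)"
      by simp
  qed simp
  finally show ?case by (simp add: avoid_prob.simps(2) sum_distrib_left)
qed

lemma AE_legal_path: "AE X in M. legal_path K X"
proof -
  have "AE X in M. \<not> (X t = v \<and> X (Suc t) = w)" if "w \<notin> set_pmf (K v)" for t v w
  proof -
    have det: "determined_by t {X. X t = v}" by (rule determined_by_at) simp
    have "prob ({X. X t = v} \<inter> {X. X (Suc t) = w}) = 0"
      using prob_next[OF det subset_refl] that by (simp add: set_pmf_iff)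
    moreover have "{X. X t = v} \<inter> {X. X (Suc t) = w} \<in> sets M"
      by (intro determined_by_in_sets[of "Suc t"] determined_by_Int determined_by_at) auto
    ultimately show ?thesis
      by (intro AE_I[where N = "{X. X t = v} \<inter> {X. X (Suc t) = w}"]) (auto simp: emeasure_eq_measure)
  qed
  then have "AE X in M. \<forall>t v w. w \<notin> set_pmf (K v) \<longrightarrow> \<not> (X t = v \<and> X (Suc t) = w)"
    by (simp only: AE_all_countable) (simp add: AE_impI)
  then show ?thesis by eventually_elim (auto simp: legal_path_def)
qed

section \<open>Attacks take place almost surely\<close>

text \<open>
  The numbers \<open>j\<close> and \<open>\<delta>\<close> depend only on the starting node and not on the past \<open>A\<close>, as multiplying
  the transition probabilities along a connecting path shows. This uniformity is what makes the
  argument for recurrence below work; the time \<open>j\<close> has to depend on \<open>v\<close> because the chain may be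
  periodic.
\<close>

lemma prob_reach:
  assumes "(v, i) \<in> {(x, y). y \<in> set_pmf (K x)}\<^sup>*"
  shows "\<exists>j \<delta>. \<delta> > 0 \<and> (\<forall>t A. determined_by t A \<longrightarrow> A \<subseteq> {X. X t = v} \<longrightarrow>
    prob (A \<inter> {X. X (t + j) = i}) \<ge> \<delta> * prob A)"
  using assms
proof (induction rule: converse_rtrancl_induct)
  case base
  have "prob (A \<inter> {X. X (t + 0) = i}) \<ge> 1 * prob A" if "A \<subseteq> {X. X t = i}" for t A
    using that by (simp add: Int_absorb2)
  then show ?case using zero_less_one by blast
next
  case (step v w)
  then obtain j \<delta> where \<delta>: "\<delta> > 0" and reach: "\<And>t A. determined_by t A \<Longrightarrow> A \<subseteq> {X. X t = w} \<Longrightarrow>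
      prob (A \<inter> {X. X (t + j) = i}) \<ge> \<delta> * prob A" by blast
  have pos: "pmf (K v) w > 0" using step by (simp add: pmf_positive_iff)
  have "prob (A \<inter> {X. X (t + Suc j) = i}) \<ge> (\<delta> * pmf (K v) w) * prob A"
    if A: "determined_by t A" "A \<subseteq> {X. X t = v}" for t A
  proof -
    let ?A = "A \<inter> {X. X (Suc t) = w}"
    have det: "determined_by (Suc t) ?A"
      by (intro determined_by_Int determined_by_at determined_by_later[OF A(1)]) auto
    have sets: "A \<inter> {X. X (t + Suc j) = i} \<in> sets M"
      by (intro determined_by_in_sets[of "t + Suc j"] determined_by_Int determined_by_at
          determined_by_later[OF A(1)]) auto
    have "(\<delta> * pmf (K v) w) * prob A = \<delta> * prob ?A" by (simp add: prob_next[OF A])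
    also have "\<dots> \<le> prob (?A \<inter> {X. X (Suc t + j) = i})" by (rule reach[OF det]) auto
    also have "\<dots> \<le> prob (A \<inter> {X. X (t + Suc j) = i})"
      by (rule finite_measure_mono[OF _ sets]) auto
    finally show ?thesis .
  qed
  then show ?case using \<delta> pos mult_pos_pos by blast
qed

text \<open>
  From every position, the chain has a chance of at least \<open>\<epsilon>\<close> to visit \<open>i\<close> and then to stay away for \<open>d\<close>
  periods within the next \<open>L\<close> periods. So the probability \<open>q\<close> that this never happens satisfies
  \<open>q \<le> (1 - \<epsilon>) * q\<close>, hence \<open>q = 0\<close>.
\<close>

lemma absence_completed_almost_surely:
  assumes irr: "irreducible_kernel K" and pos: "avoid_prob K i d i > 0"
  shows "prob {X. \<exists>t. absence_completed i d X t} = 1"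
proof -
  define G where "G N = {X. \<forall>t\<le>N. \<not> absence_completed i d X t}" for N
  have G_det: "determined_by N (G N)" for N
    unfolding determined_by_def
  proof (intro allI impI)
    fix X Y :: "nat \<Rightarrow> 'e node" assume "\<forall>u\<le>N. X u = Y u"
    then have "absence_completed i d X t \<longleftrightarrow> absence_completed i d Y t" if "t \<le> N" for t
      using that by (intro absence_completed_cong) auto
    then show "X \<in> G N \<longleftrightarrow> Y \<in> G N" by (simp add: G_def)
  qed
  have G_sets: "G N \<in> sets M" for N by (rule determined_by_in_sets[OF G_det])
  have "\<forall>v. \<exists>j \<delta>. \<delta> > 0 \<and> (\<forall>t A. determined_by t A \<longrightarrow> A \<subseteq> {X. X t = v} \<longrightarrow>
      prob (A \<inter> {X. X (t + j) = i}) \<ge> \<delta> * prob A)"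
    using prob_reach irr by (auto simp: irreducible_kernel_def)
  then obtain j \<delta> where \<delta>: "\<And>v. \<delta> v > 0" and reach: "\<And>v t A. determined_by t A \<Longrightarrow>
      A \<subseteq> {X. X t = v} \<Longrightarrow> prob (A \<inter> {X. X (t + j v) = i}) \<ge> \<delta> v * prob A"
    by metis
  define \<epsilon> where "\<epsilon> = Min (range \<delta>) * avoid_prob K i d i"
  have "\<epsilon> > 0" using \<delta> pos by (simp add: \<epsilon>_def)
  define L where "L = Max (range j) + d"
  have step: "prob (G (N + L)) \<le> (1 - \<epsilon>) * prob (G N)" for N
  proof -
    have "prob (G (N + L) \<inter> {X. X N = v}) \<le> (1 - \<epsilon>) * prob (G N \<inter> {X. X N = v})" for v
    proof -
      let ?A = "G N \<inter> {X. X N = v}"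
      let ?t = "N + j v"
      let ?B = "?A \<inter> {X. X ?t = i}"
      let ?C = "?B \<inter> {X. \<forall>u\<in>{?t<..?t + d}. X u \<noteq> i}"
      have A_det: "determined_by N ?A"
        by (intro determined_by_Int G_det determined_by_at) simp
      have B_det: "determined_by ?t ?B"
        by (intro determined_by_Int[OF determined_by_later[OF A_det]] determined_by_at) auto
      have C_det: "determined_by (?t + d) ?C"
        by (rule determined_by_Int[OF determined_by_later[OF B_det] determined_by_avoid]) simp
      have A_sets: "?A \<in> sets M" by (rule determined_by_in_sets[OF A_det])
      have C_sets: "?C \<in> sets M" by (rule determined_by_in_sets[OF C_det])
      have "\<epsilon> * prob ?A \<le> \<delta> v * avoid_prob K i d i * prob ?A"
        unfolding \<epsilon>_def using pos by (intro mult_right_mono) auto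
      also have "\<dots> \<le> prob ?B * avoid_prob K i d i"
        using mult_right_mono[OF reach[OF A_det], of v "avoid_prob K i d i"] pos by (simp add: mult_ac)
      also have "\<dots> = prob ?C"
        by (rule prob_avoid[OF B_det, symmetric]) auto
      finally have C: "\<epsilon> * prob ?A \<le> prob ?C" .
      have "j v \<le> Max (range j)" by simp
      then have "?t + d \<le> N + L" by (simp add: L_def)
      moreover have "absence_completed i d X (?t + d)" if "X \<in> ?C" for X
        using that by (auto simp: absence_completed_def)
      ultimately have "G (N + L) \<inter> {X. X N = v} \<subseteq> ?A - ?C"
        unfolding G_def by fastforce
      then have "prob (G (N + L) \<inter> {X. X N = v}) \<le> prob (?A - ?C)"
        using A_sets C_sets by (intro finite_measure_mono) auto
      also have "\<dots> = prob ?A - prob ?C"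
        using A_sets C_sets by (intro finite_measure_Diff) auto
      also have "\<dots> \<le> (1 - \<epsilon>) * prob ?A" using C by (simp add: algebra_simps)
      finally show ?thesis .
    qed
    then show ?thesis
      by (subst (1 2) prob_split_at[OF G_sets, of _ N]) (simp add: sum_distrib_left sum_mono)
  qed
  have "decseq G" unfolding decseq_def G_def by auto
  then have lim: "(\<lambda>N. prob (G N)) \<longlonglongrightarrow> prob (\<Inter>N. G N)"
    using G_sets by (intro finite_Lim_measure_decseq) auto
  have "prob (\<Inter>N. G N) \<le> (1 - \<epsilon>) * prob (\<Inter>N. G N)"
    by (rule LIMSEQ_le[OF LIMSEQ_ignore_initial_segment[OF lim, of L] tendsto_mult_left[OF lim]])
      (use step in auto)
  then have "\<epsilon> * prob (\<Inter>N. G N) \<le> 0" by (simp add: algebra_simps)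
  then have "prob (\<Inter>N. G N) = 0"
    using \<open>\<epsilon> > 0\<close> by (simp add: mult_le_0_iff order_antisym)
  moreover have "{X. \<exists>t. absence_completed i d X t} = space M - (\<Inter>N. G N)"
    by (auto simp: G_def)
  moreover have "(\<Inter>N. G N) \<in> sets M" using G_sets by auto
  ultimately show ?thesis by (simp only: prob_compl)
qed

section \<open>Interception probabilities\<close>

text \<open>
  The total probability formula for a successful attack, by the time and the position at which it begins.
\<close>

lemma success_sums:
  assumes "d \<ge> 1"
  shows "(\<lambda>t. \<Sum>v\<in>UNIV. prob (starts i d t \<inter> {X. X t = v}) * avoid_prob K i k v)
    sums (1 - interception_prob M (Suc k) (i, d))"
proof -
  let ?S = "\<lambda>t. starts i d t \<inter> {X. \<forall>u\<in>{t<..t + k}. X u \<noteq> i}"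
  have S_sets: "?S t \<in> sets M" for t
    by (rule determined_by_in_sets[OF determined_by_Int[OF determined_by_later[OF starts_det]
            determined_by_avoid]]) simp
  have "prob (?S t) = (\<Sum>v\<in>UNIV. prob (starts i d t \<inter> {X. X t = v}) * avoid_prob K i k v)" for t
  proof -
    have "prob (?S t \<inter> {X. X t = v}) = prob (starts i d t \<inter> {X. X t = v}) * avoid_prob K i k v" for v
    proof -
      have "determined_by t (starts i d t \<inter> {X. X t = v})"
        by (intro determined_by_Int starts_det determined_by_at) simp
      from prob_avoid[OF this, of v k i] show ?thesis by (simp add: Int_ac)
    qed
    then show ?thesis by (subst prob_split_at[OF S_sets, of _ t]) simp
  qed
  moreover have "(\<lambda>t. prob (?S t)) sums prob (\<Union>t. ?S t)"
    by (rule finite_measure_UNION) (use S_sets disjoint_starts in auto)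
  moreover have "prob {X. \<not> foiled (Suc k) i d X} = 1 - interception_prob M (Suc k) (i, d)"
  proof -
    have "{X. \<not> foiled (Suc k) i d X} \<in> sets M"
      unfolding not_foiled_eq[OF assms] using S_sets by auto
    from prob_compl[OF this] show ?thesis
      by (simp add: interception_prob_def Compl_eq_Diff_UNIV[symmetric] Collect_neg_eq[symmetric])
  qed
  ultimately show ?thesis by (simp add: not_foiled_eq[OF assms])
qed

lemma starts_sums: "(\<lambda>t. prob (starts i d t)) sums prob {X. \<exists>t. absence_completed i d X t}"
proof -
  have "(\<lambda>t. prob (starts i d t)) sums prob (\<Union>t. starts i d t)"
    by (rule finite_measure_UNION)
      (use determined_by_in_sets[OF starts_det] disjoint_starts[of i d "\<lambda>_. UNIV"] in auto)
  then show ?thesis by (simp only: UN_starts)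
qed

text \<open>
  Positions at the start of the attack can be computed by following a path step by step, because null
  events do not contribute.
\<close>

lemma possible_start:
  assumes "prob (starts i d t \<inter> {X. X t = v}) \<noteq> 0"
  obtains X where "legal_path K X" "absence_completed i d X t" "X t = v"
proof (rule ccontr)
  assume none: "\<not> thesis"
  have "AE X in M. X \<notin> starts i d t \<inter> {X. X t = v}"
    using AE_legal_path by eventually_elim (use none that in \<open>auto simp: starts_def\<close>)
  moreover have "starts i d t \<inter> {X. X t = v} \<in> sets M"
    by (intro determined_by_in_sets[of t] determined_by_Int starts_det determined_by_at) simp
  ultimately have "starts i d t \<inter> {X. X t = v} \<in> null_sets M"
    using AE_iff_null_sets by blast
  then have "prob (starts i d t \<inter> {X. X t = v}) = 0" by (rule measure_eq_0_null_sets)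
  with assms show False by simp
qed

text \<open>
  The success probability is an average of \<open>avoid_prob\<close> over the positions in which the attack can begin;
  the weights add up to one because the attack takes place almost surely.
\<close>

lemma interception_prob_le:
  assumes "d \<ge> 1" and attack: "prob {X. \<exists>t. absence_completed i d X t} = 1"
    and c: "\<And>X t. legal_path K X \<Longrightarrow> absence_completed i d X t \<Longrightarrow> c \<le> avoid_prob K i k (X t)"
  shows "interception_prob M (Suc k) (i, d) \<le> 1 - c"
proof -
  have "c * prob (starts i d t) \<le>
      (\<Sum>v\<in>UNIV. prob (starts i d t \<inter> {X. X t = v}) * avoid_prob K i k v)" for t
  proof -
    have "prob (starts i d t \<inter> {X. X t = v}) * c \<le>
        prob (starts i d t \<inter> {X. X t = v}) * avoid_prob K i k v" for v
    proof (cases "prob (starts i d t \<inter> {X. X t = v}) = 0")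
      case False
      then show ?thesis by (metis c measure_nonneg mult_left_mono possible_start)
    qed simp
    then show ?thesis
      by (subst prob_split_at[OF determined_by_in_sets[OF starts_det], of _ _ _ t])
        (simp add: sum_distrib_left mult.commute[of c] sum_mono)
  qed
  from sums_le[OF this sums_mult[OF starts_sums] success_sums[OF assms(1)]]
  show ?thesis by (simp add: attack)
qed

text \<open>
  Attacks that never take place count as intercepted, so the weights of the average may add up to less
  than one; this is where \<open>c \<ge> 0\<close> enters.
\<close>

lemma interception_prob_ge:
  assumes "d \<ge> 1" and "c \<ge> 0"
    and c: "\<And>X t. legal_path K X \<Longrightarrow> absence_completed i d X t \<Longrightarrow> avoid_prob K i k (X t) \<le> c"
  shows "interception_prob M (Suc k) (i, d) \<ge> 1 - c"
proof -
  have "(\<Sum>v\<in>UNIV. prob (starts i d t \<inter> {X. X t = v}) * avoid_prob K i k v) \<le>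
      c * prob (starts i d t)" for t
  proof -
    have "prob (starts i d t \<inter> {X. X t = v}) * avoid_prob K i k v \<le>
        prob (starts i d t \<inter> {X. X t = v}) * c" for v
    proof (cases "prob (starts i d t \<inter> {X. X t = v}) = 0")
      case False
      then show ?thesis by (metis c measure_nonneg mult_left_mono possible_start)
    qed simp
    then show ?thesis
      by (subst prob_split_at[OF determined_by_in_sets[OF starts_det], of _ _ _ t])
        (simp add: sum_distrib_left mult.commute[of c] sum_mono)
  qed
  from sums_le[OF this success_sums[OF assms(1)] sums_mult[OF starts_sums]]
  have "1 - interception_prob M (Suc k) (i, d) \<le> c * prob {X. \<exists>t. absence_completed i d X t}" .
  also have "\<dots> \<le> c" using assms(2) by (simp add: mult_left_le)
  finally show ?thesis by simp
qed

end


section \<open>Avoiding an end of the star\<close>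

text \<open>
  The number of arcs is a parameter of its own, so that expressions in \<open>n\<close> do not mention the type of
  the ends.
\<close>

locale star_kernel =
  fixes K :: "'e::finite kernel" and s p n :: real
  assumes n: "n = real CARD('e)"
    and s: "0 < s" "s \<le> 1" and p: "0 < p" "p \<le> 1 / n"
    and end_center: "pmf (K (End e)) Center = s"
    and end_stay: "pmf (K (End e)) (End e) = 1 - s"
    and center_stay: "pmf (K Center) Center = 1 - n * p"
    and center_end: "pmf (K Center) (End e) = p"

lemma patroller_strategy_iff_star_kernel:
  fixes K :: "'e::finite kernel"
  shows "patroller_strategy K \<longleftrightarrow> (\<exists>s p. star_kernel K s p (real CARD('e)))"
  unfolding patroller_strategy_iff star_kernel_def by simp meson

context star_kernel
begin

definition \<beta> :: real where beta_def: "\<beta> = (n - 1) / n"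

lemma n_ge_1: "n \<ge> 1"
  by (simp add: n Suc_leI)

lemma beta_bounds: "0 \<le> \<beta>" "\<beta> < 1"
  using n_ge_1 by (auto simp: beta_def)

lemma beta_pos: "n \<ge> 2 \<Longrightarrow> \<beta> > 0"
  by (simp add: beta_def)

lemma beta_one_arc:
  assumes "n = 1"
  shows "\<beta> ^ Suc j = 0"
proof -
  have "n - 1 = 0" using assms by linarith
  then have "\<beta> = 0" by (simp only: beta_def div_0)
  then show ?thesis by simp
qed

lemma beta_le: "\<beta> \<le> 1 - p"
  using p n_ge_1 by (simp add: beta_def field_simps)

lemma idle_nonneg: "0 \<le> 1 - n * p"
  using p n_ge_1 by (simp add: field_simps)

lemma pmf_other_end:
  assumes "e' \<noteq> e"
  shows "pmf (K (End e)) (End e') = 0"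
proof -
  have "sum (pmf (K (End e))) {Center, End e, End e'} \<le> sum (pmf (K (End e))) UNIV"
    by (rule sum_mono2) auto
  also have "\<dots> = 1" by (intro sum_pmf_eq_1) auto
  finally have "pmf (K (End e)) (End e') \<le> 0" using assms by (auto simp: end_center end_stay)
  then show ?thesis by (simp add: order_antisym)
qed

lemma moves_from_end: "w \<in> set_pmf (K (End e)) \<Longrightarrow> w = Center \<or> w = End e"
  using pmf_other_end[of _ e] by (cases w) (auto simp: set_pmf_iff)

lemma avoid_step:
  "avoid_prob K (End e) (Suc k) v = pmf (K v) Center * avoid_prob K (End e) k Center
    + (\<Sum>e'\<in>-{e}. pmf (K v) (End e') * avoid_prob K (End e) k (End e'))"
proof -
  have "-{End e} = insert Center (End ` (-{e}))"
    by (auto intro: node.exhaust)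
  then show ?thesis by (simp add: avoid_prob.simps(2) sum.reindex inj_on_def image_iff)
qed

lemma avoid_from_center:
  "avoid_prob K (End e) (Suc k) Center = (1 - n * p) * avoid_prob K (End e) k Center
    + p * (\<Sum>e'\<in>-{e}. avoid_prob K (End e) k (End e'))"
  by (simp only: avoid_step center_stay center_end sum_distrib_left)

lemma avoid_from_other_end:
  assumes "e' \<noteq> e"
  shows "avoid_prob K (End e) (Suc k) (End e') =
    s * avoid_prob K (End e) k Center + (1 - s) * avoid_prob K (End e) k (End e')"
proof -
  have "(\<Sum>a\<in>-{e}. pmf (K (End e')) (End a) * avoid_prob K (End e) k (End a)) =
      (\<Sum>a\<in>{e'}. pmf (K (End e')) (End a) * avoid_prob K (End e) k (End a))"
    by (rule sum.mono_neutral_right) (use assms in \<open>auto simp: pmf_other_end\<close>)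
  then show ?thesis by (simp only: avoid_step end_center) (simp add: end_stay)
qed

lemma avoid_after_leaving:
  "avoid_prob K (End e) (Suc k) (End e) = s * avoid_prob K (End e) k Center"
proof -
  have "(\<Sum>a\<in>-{e}. pmf (K (End e)) (End a) * avoid_prob K (End e) k (End a)) = 0"
    by (rule sum.neutral) (simp add: pmf_other_end)
  then show ?thesis by (simp only: avoid_step end_center)
qed

lemma card_other_ends: "real (card (-{e :: 'e})) = n - 1"
  by (simp add: n Compl_eq_Diff_UNIV of_nat_diff Suc_leI)

lemma avoid_from_center_ge:
  assumes "b \<le> avoid_prob K (End e) k Center"
    and "\<And>e'. e' \<noteq> e \<Longrightarrow> a \<le> avoid_prob K (End e) k (End e')"
  shows "(1 - n * p) * b + p * ((n - 1) * a) \<le> avoid_prob K (End e) (Suc k) Center"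
proof -
  have "real (card (-{e})) * a \<le> (\<Sum>e'\<in>-{e}. avoid_prob K (End e) k (End e'))"
    by (rule sum_bounded_below) (use assms in auto)
  then show ?thesis unfolding avoid_from_center card_other_ends
    using assms(1) idle_nonneg p by (intro add_mono mult_left_mono) auto
qed

lemma avoid_from_other_end_ge:
  assumes "e' \<noteq> e" "b \<le> avoid_prob K (End e) k Center" "a \<le> avoid_prob K (End e) k (End e')"
  shows "s * b + (1 - s) * a \<le> avoid_prob K (End e) (Suc k) (End e')"
  unfolding avoid_from_other_end[OF assms(1)]
  using assms s by (intro add_mono mult_left_mono) auto

text \<open>
  Moving to one of \<open>n\<close> ends, one of which is \<open>e\<close>, costs the same factor \<open>\<beta>\<close> that a Patroller at
  the center has already been charged. This is why one bound serves all values of \<open>p\<close>.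
\<close>

lemma beta_balance: "(1 - n * p) * (\<beta> * x) + p * ((n - 1) * x) = \<beta> * x"
  using n_ge_1 by (simp add: beta_def field_simps)

text \<open>
  With an even number of steps left, the center and the other ends have the same bound. With an odd
  number left, an end is worth as much as with one step less, since the step to the center inspects
  nothing, whereas at the center one more inspection follows and costs a factor \<open>1 - p \<ge> \<beta>\<close>. The odd
  bound at the center is kept with \<open>1 - p\<close>, because its excess over \<open>\<beta>\<close> is the gain in \<open>avoid_idle\<close>.
\<close>

lemma avoid_even_ge:
  "\<beta> ^ j \<le> avoid_prob K (End e) (2 * j) Center"
  "e' \<noteq> e \<Longrightarrow> \<beta> ^ j \<le> avoid_prob K (End e) (2 * j) (End e')"
  and avoid_odd_ge:
  "(1 - p) * \<beta> ^ j \<le> avoid_prob K (End e) (Suc (2 * j)) Center"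
  "e' \<noteq> e \<Longrightarrow> \<beta> ^ j \<le> avoid_prob K (End e) (Suc (2 * j)) (End e')"
proof -
  define even_bound where "even_bound j \<longleftrightarrow> \<beta> ^ j \<le> avoid_prob K (End e) (2 * j) Center \<and>
      (\<forall>e'. e' \<noteq> e \<longrightarrow> \<beta> ^ j \<le> avoid_prob K (End e) (2 * j) (End e'))" for j
  define odd_bound where "odd_bound j \<longleftrightarrow> (1 - p) * \<beta> ^ j \<le> avoid_prob K (End e) (Suc (2 * j)) Center \<and>
      (\<forall>e'. e' \<noteq> e \<longrightarrow> \<beta> ^ j \<le> avoid_prob K (End e) (Suc (2 * j)) (End e'))" for j
  have odd: "odd_bound j" if "even_bound j" for j
    using avoid_from_center_ge[of "\<beta> ^ j" e "2 * j" "\<beta> ^ j"]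
      avoid_from_other_end_ge[of _ e "\<beta> ^ j" "2 * j" "\<beta> ^ j"] that
    by (simp add: even_bound_def odd_bound_def algebra_simps)
  have even: "even_bound j" for j
  proof (induction j)
    case 0
    show ?case by (simp add: even_bound_def)
  next
    case (Suc j)
    from odd[OF Suc] have center: "(1 - p) * \<beta> ^ j \<le> avoid_prob K (End e) (Suc (2 * j)) Center"
      and ends: "\<And>e'. e' \<noteq> e \<Longrightarrow> \<beta> ^ j \<le> avoid_prob K (End e) (Suc (2 * j)) (End e')"
      by (auto simp: odd_bound_def)
    have "\<beta> * \<beta> ^ j \<le> (1 - p) * \<beta> ^ j"
      using beta_le beta_bounds(1) by (intro mult_right_mono zero_le_power)
    with center have center: "\<beta> * \<beta> ^ j \<le> avoid_prob K (End e) (Suc (2 * j)) Center" by linarith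
    have "(1 - n * p) * (\<beta> * \<beta> ^ j) + p * ((n - 1) * \<beta> ^ j)
        \<le> avoid_prob K (End e) (Suc (Suc (2 * j))) Center"
      by (rule avoid_from_center_ge[OF center ends])
    then have "\<beta> ^ Suc j \<le> avoid_prob K (End e) (Suc (Suc (2 * j))) Center"
      by (simp only: beta_balance power_Suc)
    moreover have "\<beta> ^ Suc j \<le> avoid_prob K (End e) (Suc (Suc (2 * j))) (End e')" if "e' \<noteq> e" for e'
    proof -
      have "(1 - s) * (\<beta> * \<beta> ^ j) \<le> (1 - s) * \<beta> ^ j"
        using s beta_bounds by (intro mult_left_mono mult_left_le_one_le) auto
      with avoid_from_other_end_ge[OF that center ends[OF that]] show ?thesis
        by (simp add: algebra_simps)
    qed
    ultimately show ?case by (simp add: even_bound_def)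
  qed
  show "\<beta> ^ j \<le> avoid_prob K (End e) (2 * j) Center"
    "e' \<noteq> e \<Longrightarrow> \<beta> ^ j \<le> avoid_prob K (End e) (2 * j) (End e')"
    using even[of j] by (auto simp: even_bound_def)
  show "(1 - p) * \<beta> ^ j \<le> avoid_prob K (End e) (Suc (2 * j)) Center"
    "e' \<noteq> e \<Longrightarrow> \<beta> ^ j \<le> avoid_prob K (End e) (Suc (2 * j)) (End e')"
    using odd[OF even[of j]] by (auto simp: odd_bound_def)
qed

lemma avoid_from_center_pos:
  assumes "n \<ge> 2"
  shows "avoid_prob K (End e) k Center > 0"
proof -
  have "\<beta> > 0" using assms by (rule beta_pos)
  moreover from this have "1 - p > 0" using beta_le by linarith
  ultimately have pos: "0 < \<beta> ^ j" "0 < (1 - p) * \<beta> ^ j" for j by simp_all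
  obtain j where "k = 2 * j \<or> k = Suc (2 * j)" by (metis oddE evenE Suc_eq_plus1)
  then show ?thesis
    using less_le_trans[OF pos(1) avoid_even_ge(1)] less_le_trans[OF pos(2) avoid_odd_ge(1)] by blast
qed

text \<open>
  Idling at the center leaves the Patroller there with an odd number of steps, where the bound
  \<open>(1 - p) * \<beta> ^ j\<close> now strictly exceeds \<open>\<beta> ^ Suc j\<close>.
\<close>

lemma avoid_idle:
  assumes "n \<ge> 2" and "p < 1 / n"
  shows "avoid_prob K (End e) (2 * Suc j) Center > \<beta> ^ Suc j"
proof -
  have "\<beta> > 0" using assms(1) by (rule beta_pos)
  have "\<beta> < 1 - p" "1 - n * p > 0" using assms by (auto simp: beta_def field_simps)
  then have "(1 - n * p) * (\<beta> * \<beta> ^ j) < (1 - n * p) * ((1 - p) * \<beta> ^ j)"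
    using \<open>\<beta> > 0\<close> by (intro mult_strict_left_mono mult_strict_right_mono) auto
  moreover have "(1 - n * p) * ((1 - p) * \<beta> ^ j) + p * ((n - 1) * \<beta> ^ j)
      \<le> avoid_prob K (End e) (Suc (Suc (2 * j))) Center"
    by (rule avoid_from_center_ge[OF avoid_odd_ge(1) avoid_odd_ge(2)])
  ultimately show ?thesis
    using beta_balance[of "\<beta> ^ j"] by simp
qed

text \<open>
  Lingering at another end turns the even number of steps left into an odd one, where an end is worth
  \<open>\<beta> ^ j\<close> instead of \<open>\<beta> ^ Suc j\<close>.
\<close>

lemma avoid_linger:
  assumes "e' \<noteq> e"
  shows "s * \<beta> ^ Suc j + (1 - s) * \<beta> ^ j \<le> avoid_prob K (End e) (2 * Suc j) (End e')"
proof -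
  have "\<beta> * \<beta> ^ j \<le> (1 - p) * \<beta> ^ j"
    using beta_le beta_bounds(1) by (intro mult_right_mono zero_le_power)
  then have "\<beta> ^ Suc j \<le> avoid_prob K (End e) (Suc (2 * j)) Center"
    using avoid_odd_ge(1)[of j e] by simp
  from avoid_from_other_end_ge[OF assms this avoid_odd_ge(2)[OF assms]]
  show ?thesis by simp
qed

lemma linger_gain:
  assumes "n \<ge> 2" and "s < 1"
  shows "\<beta> ^ Suc j < s * \<beta> ^ Suc j + (1 - s) * \<beta> ^ j"
proof -
  have "\<beta> > 0" using assms(1) by (rule beta_pos)
  then have "(1 - s) * (\<beta> * \<beta> ^ j) < (1 - s) * (1 * \<beta> ^ j)"
    using assms(2) beta_bounds(2) by (intro mult_strict_left_mono mult_strict_right_mono) auto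
  then show ?thesis by (simp add: algebra_simps)
qed

text \<open>
  Going to another end leaves an odd number of steps, where lingering once merely restores an even
  number without any gain; the gain comes from lingering twice. So at least four steps are required.
\<close>

lemma avoid_linger_center:
  assumes "n \<ge> 2" and "s < 1"
  shows "avoid_prob K (End e) (2 * Suc (Suc j)) Center > \<beta> ^ Suc (Suc j)"
proof -
  let ?x = "\<beta> ^ Suc j" and ?y = "s * \<beta> ^ Suc j + (1 - s) * \<beta> ^ j"
  have gain: "?x < ?y" by (rule linger_gain[OF assms])
  have "\<beta> * ?x \<le> (1 - p) * ?x"
    using beta_le beta_bounds(1) by (intro mult_right_mono zero_le_power)
  then have center: "\<beta> * ?x \<le> avoid_prob K (End e) (Suc (2 * Suc j)) Center"
    using avoid_odd_ge(1)[of "Suc j" e] by linarith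
  have "s * ?x + (1 - s) * ?y \<le> avoid_prob K (End e) (Suc (2 * Suc j)) (End e')" if "e' \<noteq> e" for e'
    by (rule avoid_from_other_end_ge[OF that avoid_even_ge(1) avoid_linger[OF that]])
  from avoid_from_center_ge[OF center this]
  have "(1 - n * p) * (\<beta> * ?x) + p * ((n - 1) * (s * ?x + (1 - s) * ?y))
      \<le> avoid_prob K (End e) (2 * Suc (Suc j)) Center" by simp
  moreover have "p * ((n - 1) * ?x) < p * ((n - 1) * (s * ?x + (1 - s) * ?y))"
  proof (intro mult_strict_left_mono)
    have "(1 - s) * ?x < (1 - s) * ?y" using gain assms(2) by simp
    then show "?x < s * ?x + (1 - s) * ?y" by (simp add: algebra_simps)
  qed (use p assms(1) in auto)
  ultimately show ?thesis using beta_balance[of ?x] by simp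
qed

lemma avoid_random_walk:
  assumes "s = 1" and "p = 1 / n" and "v \<noteq> End e"
  shows "avoid_prob K (End e) (2 * j) v = \<beta> ^ j"
proof -
  have center: "avoid_prob K (End e) (Suc k) Center =
      1 / n * (\<Sum>e'\<in>-{e}. avoid_prob K (End e) k (End e'))" for k
    using assms n_ge_1 by (simp add: avoid_from_center)
  have other: "e' \<noteq> e \<Longrightarrow> avoid_prob K (End e) (Suc k) (End e') = avoid_prob K (End e) k Center" for k e'
    using assms by (simp add: avoid_from_other_end)
  have "avoid_prob K (End e) (2 * j) Center = \<beta> ^ j \<and>
      (\<forall>e'. e' \<noteq> e \<longrightarrow> avoid_prob K (End e) (2 * j) (End e') = \<beta> ^ j)"
  proof (induction j)
    case (Suc j)
    then show ?case
      by (simp add: center other card_other_ends beta_def)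
  qed simp
  then show ?thesis using assms(3) by (cases v) auto
qed

lemma strategy: "patroller_strategy K"
  using patroller_strategy_iff_star_kernel star_kernel_axioms n by blast

lemma irreducible: "irreducible_kernel K"
  using strategy by (simp add: patroller_strategy_def)

end

lemma star_kernel_unique:
  assumes "star_kernel K s p n" and "star_kernel K' s p n"
  shows "K = K'"
proof
  interpret K: star_kernel K s p n by fact
  interpret K': star_kernel K' s p n by fact
  fix u
  have "pmf (K u) v = pmf (K' u) v" for v
  proof (cases u; cases v)
    fix e e' assume "u = End e" "v = End e'"
    then show ?thesis
      by (cases "e' = e") (auto simp: K.end_stay K'.end_stay K.pmf_other_end K'.pmf_other_end)
  qed (auto simp: K.center_stay K'.center_stay K.center_end K'.center_end K.end_center K'.end_center)
  then show "K u = K' u" by (rule pmf_eqI)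
qed

lemma star_kernel_random_walk:
  "star_kernel (random_walk :: 'e::finite kernel) 1 (1 / real CARD('e)) (real CARD('e))"
proof -
  have ends: "{v. adj Center v} = range (End :: 'e \<Rightarrow> 'e node)"
    by (auto elim: adj.elims)
  have center: "{v. adj (End e :: 'e node) v} = {Center}" for e
    by (auto elim: adj.elims)
  have "card (range (End :: 'e \<Rightarrow> 'e node)) = CARD('e)"
    by (simp add: card_image inj_on_def)
  then show ?thesis
    by unfold_locales (auto simp: random_walk_def ends center indicator_def)
qed

section \<open>The game on the star\<close>

locale star_chain = star_kernel K s p n + chain K M
  for K :: "'e::finite kernel" and s p n M
begin

lemma position_after_one:
  assumes "legal_path K X" "absence_completed (End e) 1 X t"
  shows "X t = Center"
proof -
  from assms(2) obtain u where u: "t = Suc u" "X u = End e" "X t \<noteq> End e"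
    by (cases t) (auto simp: absence_completed_def)
  with assms(1) have "X t \<in> set_pmf (K (End e))" unfolding legal_path_def by metis
  with u show ?thesis using moves_from_end by blast
qed

text \<open>
  Never idling at the center (\<open>p = 1/n\<close>) forces the second period of absence to be spent at an end.
\<close>

lemma position_after_two:
  assumes "p = 1 / n" "legal_path K X" "absence_completed (End e) 2 X t"
  obtains e' where "X t = End e'" "e' \<noteq> e"
proof -
  define u where "u = t - 2"
  have u: "t = Suc (Suc u)" "X u = End e" "X (Suc u) \<noteq> End e" "X t \<noteq> End e"
    using assms(3) by (auto simp: absence_completed_def u_def)
  have "X (Suc u) \<in> set_pmf (K (X u))" "X t \<in> set_pmf (K (X (Suc u)))"
    using assms(2) u(1) by (auto simp: legal_path_def)
  with u have "X t \<in> set_pmf (K Center)" using moves_from_end by metis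
  moreover have "Center \<notin> set_pmf (K Center)"
    using assms(1) n_ge_1 by (simp add: set_pmf_iff center_stay)
  ultimately show thesis using that u(4) by (cases "X t") auto
qed

text \<open>
  With a single arc only delay one can lead to an attack at the end unless the Patroller idles at the
  center; with at least two arcs every absence can be prolonged by visiting another end.
\<close>

lemma attack_at_end:
  assumes "n \<ge> 2 \<or> d = 1" and "d \<ge> 1"
  shows "prob {X. \<exists>t. absence_completed (End e) d X t} = 1"
proof (rule absence_completed_almost_surely[OF irreducible])
  obtain k where k: "d = Suc k" using assms(2) by (cases d) auto
  show "avoid_prob K (End e) d (End e) > 0"
    unfolding k avoid_after_leaving
    using assms(1) avoid_from_center_pos[of e k] s by (cases k) (auto simp: k)
qed

lemma n_cases: "n = 1 \<or> n \<ge> 2"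
  using n by (cases "CARD('e)") (auto simp: Suc_le_eq)

lemma interception_at_end_le:
  assumes "d \<ge> 1"
  shows "interception_prob M (Suc (2 * Suc j)) (End e, d) \<le> 1 - \<beta> ^ Suc j"
  using n_cases
proof
  assume "n \<ge> 2"
  then show ?thesis
  proof (intro interception_prob_le[OF assms attack_at_end])
    fix X t assume "absence_completed (End e) d X t"
    then have "X t \<noteq> End e" using assms by (auto simp: absence_completed_def)
    then show "\<beta> ^ Suc j \<le> avoid_prob K (End e) (2 * Suc j) (X t)"
      using avoid_even_ge(1)[of "Suc j" e] avoid_even_ge(2)[of _ e "Suc j"] by (cases "X t") auto
  qed (use assms in auto)
next
  assume "n = 1"
  then show ?thesis unfolding beta_one_arc[OF \<open>n = 1\<close>] by (simp add: interception_prob_def)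
qed

text \<open>
  At an end the bound is the exact value; at the center the attack is intercepted in its first step
  because the random walk reflects at the ends.
\<close>

lemma random_walk_interception_ge:
  assumes "s = 1" and "p = 1 / n" and "d \<ge> 1"
  shows "interception_prob M (Suc (2 * Suc j)) (i, d) \<ge> 1 - \<beta> ^ Suc j"
proof (rule interception_prob_ge[OF assms(3)])
  fix X t assume "absence_completed i d X t"
  then have away: "X t \<noteq> i" using assms(3) by (auto simp: absence_completed_def)
  show "avoid_prob K i (2 * Suc j) (X t) \<le> \<beta> ^ Suc j"
  proof (cases i)
    case (End e)
    then show ?thesis using avoid_random_walk[of "X t" e "Suc j"] assms away by simp
  next
    case Center
    then obtain e where e: "X t = End e" using away by (cases "X t") auto
    have "pmf (K (End e)) w = 0" if "w \<in> -{Center}" for w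
      using that assms(1) end_stay pmf_other_end by (cases w; cases "w = End e") auto
    then have "avoid_prob K Center (Suc k) (End e) = 0" for k
      by (simp add: avoid_prob.simps(2))
    then show ?thesis using Center e zero_le_power[OF beta_bounds(1), of "Suc j"]
      by (simp del: power_Suc)
  qed
qed (use beta_bounds in simp)

text \<open>
  The hypothesis on \<open>D\<close> and \<open>j\<close> excludes the only case in which lingering at the ends goes
  unpunished: delay one with two steps left after the start of the attack, which do not suffice to
  reach another end and to profit from lingering there.
\<close>

lemma exploitable_unless_random_walk:
  assumes not_rw: "\<not> (s = 1 \<and> p = 1 / n)" and D: "D \<ge> 1" "D \<ge> 2 \<or> j \<ge> 1 \<or> n = 1"
  obtains a where "a \<in> attacker_strategies D"
    "interception_prob M (Suc (2 * Suc j)) a < 1 - \<beta> ^ Suc j"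
proof -
  let ?m = "Suc (2 * Suc j)"
  let ?e = "undefined :: 'e"
  note exploit = that
  have delay_one: thesis if "avoid_prob K (End ?e) (2 * Suc j) Center > \<beta> ^ Suc j"
  proof (rule exploit[of "(End ?e, 1)"])
    have "interception_prob M ?m (End ?e, 1) \<le> 1 - avoid_prob K (End ?e) (2 * Suc j) Center"
      by (rule interception_prob_le[OF _ attack_at_end]) (auto simp: position_after_one)
    with that show "interception_prob M ?m (End ?e, 1) < 1 - \<beta> ^ Suc j" by linarith
  qed (use D in \<open>auto simp: attacker_strategies_def\<close>)
  have "p < 1 / n \<or> p = 1 / n" "s < 1 \<or> s = 1" using s p by auto
  then consider "n = 1" "p < 1 / n" | "n = 1" "p = 1 / n" "s < 1" | "n \<ge> 2" "p < 1 / n"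
    | "n \<ge> 2" "s < 1" "j \<ge> 1" | "n \<ge> 2" "p = 1 / n" "s < 1" "D \<ge> 2"
    using n_cases not_rw D(2) by blast
  then show thesis
  proof cases
    case 1
    have "(1 - p) ^ k \<le> avoid_prob K (End ?e) k Center" for k
    proof (induction k)
      case (Suc k)
      have "(1 - p) * (1 - p) ^ k \<le> (1 - p) * avoid_prob K (End ?e) k Center"
        using 1 Suc by (intro mult_left_mono) auto
      also have "\<dots> \<le> avoid_prob K (End ?e) (Suc k) Center"
        unfolding avoid_from_center using 1 p by (simp add: sum_nonneg avoid_prob_nonneg)
      finally show ?case by simp
    qed simp
    moreover have "(1 - p) ^ (2 * Suc j) > 0" using 1 by simp
    ultimately have "avoid_prob K (End ?e) (2 * Suc j) Center > 0" by (rule less_le_trans[rotated])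
    then show thesis by (intro delay_one) (simp only: beta_one_arc[OF 1(1)])
  next
    case 2
    \<comment> \<open>The only attack that works here is at the center: the Patroller may linger at the end throughout.\<close>
    have linger: "(1 - s) ^ k \<le> avoid_prob K Center k (End e)" for k e
    proof (induction k)
      case (Suc k)
      have "(1 - s) * (1 - s) ^ k \<le> pmf (K (End e)) (End e) * avoid_prob K Center k (End e)"
        unfolding end_stay using 2 Suc by (intro mult_left_mono) auto
      also have "\<dots> \<le> avoid_prob K Center (Suc k) (End e)"
        unfolding avoid_prob.simps by (rule member_le_sum) (auto simp: avoid_prob_nonneg)
      finally show ?case by simp
    qed simp
    have "pmf (K Center) (End ?e) * 1 \<le> avoid_prob K Center 1 Center"
      unfolding One_nat_def avoid_prob.simps by (rule member_le_sum) auto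
    then have "avoid_prob K Center 1 Center > 0" using p by (simp add: center_end)
    then have attack: "prob {X. \<exists>t. absence_completed Center 1 X t} = 1"
      by (rule absence_completed_almost_surely[OF irreducible])
    have "interception_prob M ?m (Center, 1) \<le> 1 - (1 - s) ^ (2 * Suc j)"
    proof (rule interception_prob_le[OF _ attack])
      fix X :: "nat \<Rightarrow> 'e node" and t assume "absence_completed Center 1 X t"
      then have "X t \<noteq> Center" by (auto simp: absence_completed_def)
      then show "(1 - s) ^ (2 * Suc j) \<le> avoid_prob K Center (2 * Suc j) (X t)"
        using linger[of "2 * Suc j"] by (cases "X t") auto
    qed simp
    moreover have "(1 - s) ^ (2 * Suc j) > 0" using 2 by simp
    ultimately have "interception_prob M ?m (Center, 1) < 1 - \<beta> ^ Suc j"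
      unfolding beta_one_arc[OF 2(1)] by linarith
    then show thesis using D by (intro exploit) (auto simp: attacker_strategies_def)
  next
    case 3
    then show thesis by (intro delay_one avoid_idle)
  next
    case 4
    then obtain j' where "j = Suc j'" by (cases j) auto
    then show thesis using 4 avoid_linger_center by (intro delay_one) simp
  next
    case 5
    let ?c = "s * \<beta> ^ Suc j + (1 - s) * \<beta> ^ j"
    have "interception_prob M ?m (End ?e, 2) \<le> 1 - ?c"
    proof (rule interception_prob_le[OF _ attack_at_end])
      fix X t assume "legal_path K X" "absence_completed (End ?e) 2 X t"
      then show "?c \<le> avoid_prob K (End ?e) (2 * Suc j) (X t)"
        using position_after_two[OF 5(2)] avoid_linger by metis
    qed (use 5 in auto)
    also have "\<dots> < 1 - \<beta> ^ Suc j" using linger_gain[of j] 5 by linarith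
    finally show thesis using 5 by (intro exploit) (auto simp: attacker_strategies_def)
  qed
qed

end

theorem proposition2:
  fixes P :: "'e::finite kernel \<Rightarrow> (nat \<Rightarrow> 'e node) measure"
    and m D :: nat
  assumes "\<And>K. patroller_strategy K \<Longrightarrow> markov_chain_law K (P K)"
    and "m \<ge> 2" and "odd m" and "D \<ge> 1"
  shows "optimal_patroller P m D random_walk
    \<and> (D \<ge> 2 \<or> m \<noteq> 3 \<or> CARD('e) = 1 \<longrightarrow> (\<forall>K. optimal_patroller P m D K \<longrightarrow> K = random_walk))
    \<and> (\<forall>e. \<forall>d \<in> {1..D}. optimal_attacker P m D (End e, d))
    \<and> game_value P m D = 1 - ((real CARD('e) - 1) / real CARD('e)) ^ ((m - 1) div 2)"
proof -
  let ?n = "real CARD('e)"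
  obtain k where "m = 2 * k + 1" using \<open>odd m\<close> by (rule oddE)
  moreover from this \<open>m \<ge> 2\<close> obtain j where "k = Suc j" by (cases k) auto
  ultimately have m: "m = Suc (2 * Suc j)" by simp
  define V where "V = 1 - ((?n - 1) / ?n) ^ Suc j"
  have chain: "star_chain K s p ?n (P K)" if "star_kernel K s p ?n" for K s p
  proof -
    have "patroller_strategy K" using that patroller_strategy_iff_star_kernel by blast
    with that assms(1) show ?thesis by (simp add: star_chain_def chain_def)
  qed
  have fin: "finite (attacker_strategies D :: ('e node \<times> nat) set)"
    by (simp add: attacker_strategies_def)
  have end_strategy: "(End e, d) \<in> attacker_strategies D" if "d \<in> {1..D}" for e :: 'e and d
    using that by (simp add: attacker_strategies_def)
  have guaranteed_le: "guaranteed_prob P m D K \<le> interception_prob (P K) m a"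
    if "a \<in> attacker_strategies D" for K a
    unfolding guaranteed_prob_def using fin that by (intro Min_le) auto
  have end_le: "interception_prob (P K) m (End e, d) \<le> V" if "patroller_strategy K" "d \<ge> 1" for K e d
  proof -
    obtain s p where "star_kernel K s p ?n" using \<open>patroller_strategy K\<close> patroller_strategy_iff_star_kernel by blast
    then interpret star_chain K s p ?n "P K" by (rule chain)
    show ?thesis unfolding m V_def beta_def[symmetric] by (rule interception_at_end_le) fact
  qed
  have le_V: "guaranteed_prob P m D K \<le> V" if "patroller_strategy K" for K
    using guaranteed_le[OF end_strategy[of 1]] end_le[OF that, of 1] \<open>D \<ge> 1\<close> by (force intro: order_trans)
  interpret rw: star_chain random_walk 1 "1 / ?n" ?n "P random_walk"
    by (rule chain[OF star_kernel_random_walk])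
  have "guaranteed_prob P m D random_walk \<ge> V"
    unfolding guaranteed_prob_def
  proof (rule Min.boundedI)
    show "interception_prob (P random_walk) m ` attacker_strategies D \<noteq> {}"
      using end_strategy[of 1] \<open>D \<ge> 1\<close> by auto
    fix x assume "x \<in> interception_prob (P random_walk) m ` attacker_strategies D"
    then show "V \<le> x"
      using rw.random_walk_interception_ge[of _ j]
      unfolding m V_def rw.beta_def attacker_strategies_def by auto
  qed (use fin in auto)
  with le_V[OF rw.strategy] have rw_V: "guaranteed_prob P m D random_walk = V" by (rule antisym)
  have "game_value P m D = V"
    unfolding game_value_def
  proof (rule cSup_eq_maximum)
    show "V \<in> guaranteed_prob P m D ` Collect patroller_strategy"
      using rw_V rw.strategy by blast
  qed (use le_V in auto)
  moreover have "optimal_patroller P m D random_walk"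
    using rw.strategy rw_V \<open>game_value P m D = V\<close> by (simp add: optimal_patroller_def)
  moreover have "K = random_walk"
    if D: "D \<ge> 2 \<or> m \<noteq> 3 \<or> CARD('e) = 1" and K: "optimal_patroller P m D K" for K
  proof -
    have "patroller_strategy K" using K by (simp add: optimal_patroller_def)
    then obtain s p where star: "star_kernel K s p ?n"
      using patroller_strategy_iff_star_kernel by blast
    then interpret star_chain K s p ?n "P K" by (rule chain)
    have "s = 1 \<and> p = 1 / ?n"
    proof (rule ccontr)
      assume "\<not> ?thesis"
      moreover have "D \<ge> 2 \<or> j \<ge> 1 \<or> ?n = 1" using D m by auto
      ultimately obtain a where "a \<in> attacker_strategies D" "interception_prob (P K) m a < V"
        unfolding m V_def beta_def[symmetric] using exploitable_unless_random_walk \<open>D \<ge> 1\<close> by blast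
      then have "guaranteed_prob P m D K < V" using guaranteed_le by (blast intro: le_less_trans)
      then show False using K \<open>game_value P m D = V\<close> by (simp add: optimal_patroller_def)
    qed
    then show ?thesis using star star_kernel_unique star_kernel_random_walk by blast
  qed
  moreover have "optimal_attacker P m D (End e, d)" if "d \<in> {1..D}" for e d
    using that end_strategy end_le \<open>game_value P m D = V\<close> by (auto simp: optimal_attacker_def)
  moreover have "(m - 1) div 2 = Suc j" by (simp add: m)
  ultimately show ?thesis by (auto simp: V_def)
qed

end
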